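(* Let $n$ be a positive integer, $\nu>0$, and $\boldsymbol{y}\in\mathbb{R}^n_{\downarrow}$. Then $$ \mathrm{prox}_{\nu\|\cdot\|_1^{2/3}}(\boldsymbol{y})=\begin{cases} \{\boldsymbol{0}_n\}, & \text{if } \|\boldsymbol{y}\|_1\le 4\left(\frac29\right)^{3/4}\nu^{3/4},\\ \{\boldsymbol{y}-c_n\boldsymbol{1}_n\}, & \text{if } \boldsymbol{y}\succ 2\left(\frac23\nu\right)^{3/4}\boldsymbol{1}_n,\\ \arg\min_{\boldsymbol{u}\in S_{2/3}(\boldsymbol{y})}J_{\boldsymbol{y}}(\boldsymbol{u}), & \text{if } \|\boldsymbol{y}\|_\infty>2\left(\frac23\nu\right)^{3/4}\text{ and }\boldsymbol{y}\nsucc 2\left(\frac23\nu\right)^{3/4}\boldsymbol{1}_n,\\ \arg\min_{\boldsymbol{u}\in\{\boldsymbol{0}_n\}\cup S_{2/3}(\boldsymbol{y})}J_{\boldsymbol{y}}(\boldsymbol{u}), & \text{otherwise.} \end{cases} $$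
   Context: $[n]=\{1,\dots,n\}$. $\mathbb{R}^n_{\downarrow}=\{\boldsymbol{z}\in\mathbb{R}^n: z_1\ge\cdots\ge z_n\ge 0\}$. $\boldsymbol{0}_n,\boldsymbol{1}_n\in\mathbb{R}^n$ are the all-zeros and all-ones vectors. $\|\boldsymbol{u}\|_1=\sum_i|u_i|$, $\|\boldsymbol{u}\|_\infty=\max_i|u_i|$. For $\boldsymbol{y}\in\mathbb{R}^n_\downarrow$ and $s\in[n]$, $\|\boldsymbol{y}\|_{(s)}=\sum_{i=1}^s y_i$. $\boldsymbol{y}\succ\boldsymbol{z}$ means $y_i>z_i$ for all $i\in[n]$, and $\boldsymbol{y}\nsucc\boldsymbol{z}$ is its negation. The maximum of two vectors is componentwise. The (set-valued) proximal operator is $\mathrm{prox}_{\nu\|\cdot\|_1^{2/3}}(\boldsymbol{y})=\arg\min_{\boldsymbol{u}\in\mathbb{R}^n}J_{\boldsymbol{y}}(\boldsymbol{u})$, where $J_{\boldsymbol{y}}(\boldsymbol{u})=\nu\|\boldsymbol{u}\|_1^{2/3}+\frac12\|\boldsymbol{u}-\boldsymbol{y}\|_2^2$; $\arg\min$ denotes the set of all minimizers. For $s\in[n]$ with $\|\boldsymbol{y}\|_{(s)}\ge\left(\frac43\cdot\frac{2^{3/4}}{3^{1/2}}\nu^{3/4}\right)s^{3/4}$, put $$\alpha=\left(\frac{\|\boldsymbol{y}\|_{(s)}^2}{16}+\sqrt{\frac{\|\boldsymbol{y}\|_{(s)}^4}{256}-\frac{8\nu^3s^3}{729}}\right)^{1/3}+\left(\frac{\|\boldsymbol{y}\|_{(s)}^2}{16}-\sqrt{\frac{\|\boldsymbol{y}\|_{(s)}^4}{256}-\frac{8\nu^3s^3}{729}}\right)^{1/3}$$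 and $$c_s=\frac{4\nu}{3}\cdot\frac{1}{\sqrt{2\alpha}+\sqrt{\frac{2\|\boldsymbol{y}\|_{(s)}}{\sqrt{2\alpha}}-2\alpha}}.$$ $S_{2/3}(\boldsymbol{y})$ is the set of all vectors $\max\{\boldsymbol{y}-c_s\boldsymbol{1}_n,\boldsymbol{0}_n\}$, where $s$ ranges over those $s\in[n]$ such that $\|\boldsymbol{y}\|_{(s)}\ge\left(\frac43\cdot\frac{2^{3/4}}{3^{1/2}}\nu^{3/4}\right)s^{3/4}$, $y_s>c_s$, and $y_i\le c_s$ for all $i\in\{s+1,\dots,n\}$. *)

theory Defs
  imports "HOL-Analysis.Analysis"
begin

text \<open>
  Vectors in \<open>\<real>\<^sup>n\<close> are functions on the index set \<open>{1..n}\<close> that take the fixed value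
  \<^const>\<open>undefined\<close> outside it, so that two vectors are equal iff their \<open>n\<close> components agree.
\<close>

type_synonym rvec = "nat \<Rightarrow> real"

definition Rn :: "nat \<Rightarrow> rvec set" where
  "Rn n = {1..n} \<rightarrow>\<^sub>E UNIV"

definition Rn_down :: "nat \<Rightarrow> rvec set" where
  "Rn_down n = {z \<in> Rn n. (\<forall>i\<in>{1..n}. \<forall>j\<in>{1..n}. i \<le> j \<longrightarrow> z j \<le> z i) \<and> (\<forall>i\<in>{1..n}. 0 \<le> z i)}"

definition zero_vec :: "nat \<Rightarrow> rvec" where
  "zero_vec n = (\<lambda>i\<in>{1..n}. 0)"

definition norm1 :: "nat \<Rightarrow> rvec \<Rightarrow> real" where
  "norm1 n u = (\<Sum>i=1..n. \<bar>u i\<bar>)"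

definition norm_inf :: "nat \<Rightarrow> rvec \<Rightarrow> real" where
  "norm_inf n u = Max ((\<lambda>i. \<bar>u i\<bar>) ` {1..n})"

text \<open>\<open>\<parallel>y\<parallel>\<^bsub>(s)\<^esub>\<close>, the sum of the \<open>s\<close> leading entries; used for \<open>y \<in> Rn_down n\<close> only.\<close>

definition top_sum :: "nat \<Rightarrow> rvec \<Rightarrow> real" where
  "top_sum s y = (\<Sum>i=1..s. y i)"

definition argmin_set :: "('a \<Rightarrow> real) \<Rightarrow> 'a set \<Rightarrow> 'a set" where
  "argmin_set f A = {u. is_arg_min f (\<lambda>v. v \<in> A) u}"

definition J_fun :: "nat \<Rightarrow> real \<Rightarrow> rvec \<Rightarrow> rvec \<Rightarrow> real" where
  "J_fun n \<nu> y u = \<nu> * norm1 n u powr (2/3) + 1/2 * (L2_set (\<lambda>i. u i - y i) {1..n})\<^sup>2"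

definition prox :: "nat \<Rightarrow> real \<Rightarrow> rvec \<Rightarrow> rvec set" where
  "prox n \<nu> y = argmin_set (J_fun n \<nu> y) (Rn n)"

definition admissible :: "real \<Rightarrow> rvec \<Rightarrow> nat \<Rightarrow> bool" where
  "admissible \<nu> y s \<longleftrightarrow>
     top_sum s y \<ge> (4/3 * (2 powr (3/4) / 3 powr (1/2)) * \<nu> powr (3/4)) * real s powr (3/4)"

text \<open>
  \<open>\<alpha>\<close> and \<open>c\<^sub>s\<close> are meaningful for \<^const>\<open>admissible\<close> \<open>s\<close> only: admissibility is what makes the
  inner square root in \<open>\<alpha>\<close> real.
\<close>

definition alpha :: "real \<Rightarrow> rvec \<Rightarrow> nat \<Rightarrow> real" where
  "alpha \<nu> y s =
     root 3 ((top_sum s y)\<^sup>2 / 16 + sqrt ((top_sum s y)^4 / 256 - 8 * \<nu>^3 * real s^3 / 729)) +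
     root 3 ((top_sum s y)\<^sup>2 / 16 - sqrt ((top_sum s y)^4 / 256 - 8 * \<nu>^3 * real s^3 / 729))"

definition c_s :: "real \<Rightarrow> rvec \<Rightarrow> nat \<Rightarrow> real" where
  "c_s \<nu> y s = 4 * \<nu> / 3 *
     (1 / (sqrt (2 * alpha \<nu> y s)
           + sqrt (2 * top_sum s y / sqrt (2 * alpha \<nu> y s) - 2 * alpha \<nu> y s)))"

definition S23 :: "nat \<Rightarrow> real \<Rightarrow> rvec \<Rightarrow> rvec set" where
  "S23 n \<nu> y =
     {(\<lambda>i\<in>{1..n}. max (y i - c_s \<nu> y s) 0) | s.
        s \<in> {1..n} \<and> admissible \<nu> y s \<and> y s > c_s \<nu> y s \<and> (\<forall>i\<in>{s+1..n}. y i \<le> c_s \<nu> y s)}"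

text \<open>\<open>y \<succ> a 1\<^sub>n\<close>.\<close>

definition all_gt :: "nat \<Rightarrow> rvec \<Rightarrow> real \<Rightarrow> bool" where
  "all_gt n y a \<longleftrightarrow> (\<forall>i\<in>{1..n}. y i > a)"

end

theory Submission
  imports Defs
begin

text \<open>
  The case distinction rests on a description of the nonzero minimizers. As \<open>x powr (2/3)\<close> is
  concave, it lies below its tangent at \<open>r = \<parallel>u\<parallel>\<^sub>1\<close>, whose slope times \<open>\<nu>\<close> is \<open>c = 2 * \<nu> / (3 * t)\<close>
  with \<open>t = root 3 r\<close>. Hence a minimizer \<open>u\<close> also minimizes the convex function
  \<open>c * \<parallel>v\<parallel>\<^sub>1 + \<parallel>v - y\<parallel>\<^sup>2 / 2\<close>, whose only minimizer is the soft thresholding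
  \<open>max (y i - c) 0\<close> (\<open>minimizer_is_soft_threshold\<close>). Since \<open>y\<close> is
  nonincreasing, the support is an initial segment \<open>{1..s}\<close>, and summing over it gives the
  quartic equation \<open>T * t = t ^ 4 + 2/3 * \<nu> * s\<close> with
  \<open>T = top_sum s y\<close>.

  In general this quartic has two positive roots. Moving \<open>u\<close> along the all-ones vector of its
  support shows that a minimizer belongs to the larger one, \<open>t ^ 4 \<ge> 2/9 * \<nu> * s\<close>
  (\<open>minimizer_curvature\<close>). The formulas of Cardano and Ferrari identify the larger root, which
  turns \<open>c\<close> into \<open>c_s \<nu> y s\<close> (\<open>c_s_eq\<close>), and the least value of \<open>T\<close> for which a positive
  root exists is the admissibility threshold (\<open>admissible_of_quartic\<close>).

  So every minimizer is \<open>0\<close> or lies in \<open>S23\<close>. Minimizers exist by compactness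
  (\<open>prox_nonempty\<close>), and a set between \<open>prox\<close> and \<open>Rn\<close> has the same minimizers as \<open>Rn\<close>. It
  remains to see when \<open>0\<close> or a nonzero vector can be excluded. Comparison with \<open>0\<close> forces the
  stronger bound \<open>t ^ 4 \<ge> 2/3 * \<nu>\<close> on nonzero minimizers, which settles the first case. If some
  \<open>y i\<close> exceeds \<open>2 * (2/3 * \<nu>) powr (3/4)\<close>, then a multiple of the \<open>i\<close>-th unit vector is better
  than \<open>0\<close>. If all of them do, then the threshold \<open>c\<close> is below every entry and \<open>s = n\<close>.
\<close>

section \<open>The objective and its minimizers\<close>

lemma J_fun_eq: "J_fun n \<nu> y u = \<nu> * norm1 n u powr (2/3) + (\<Sum>i=1..n. (u i - y i)\<^sup>2) / 2"
  by (simp add: J_fun_def L2_set_def sum_nonneg)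

lemma prox_iff: "u \<in> prox n \<nu> y \<longleftrightarrow> u \<in> Rn n \<and> (\<forall>v\<in>Rn n. J_fun n \<nu> y u \<le> J_fun n \<nu> y v)"
  by (auto simp: prox_def argmin_set_def is_arg_min_def not_less)

lemma argmin_set_between:
  assumes "argmin_set f B \<noteq> {}" "argmin_set f B \<subseteq> A" "A \<subseteq> B"
  shows "argmin_set f B = argmin_set f A"
proof -
  have mem: "u \<in> argmin_set f C \<longleftrightarrow> u \<in> C \<and> (\<forall>v\<in>C. f u \<le> f v)" for u C
    by (auto simp: argmin_set_def is_arg_min_def not_less)
  obtain w where w: "w \<in> argmin_set f B" using assms(1) by blast
  have wA: "w \<in> A" using assms(2) w by blast
  show ?thesis
  proof (intro equalityI subsetI)
    fix u assume u: "u \<in> argmin_set f B"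
    then have "u \<in> A" using assms(2) by blast
    then show "u \<in> argmin_set f A" using u assms(3) by (auto simp: mem)
  next
    fix u assume u: "u \<in> argmin_set f A"
    then have "f u \<le> f w" using wA by (simp add: mem)
    moreover have "f w \<le> f v" if "v \<in> B" for v using w that by (simp add: mem)
    ultimately have "f u \<le> f v" if "v \<in> B" for v using that by (meson order_trans)
    then show "u \<in> argmin_set f B" using u assms(3) by (auto simp: mem)
  qed
qed

lemma norm1_nonneg [simp]: "0 \<le> norm1 n u"
  by (simp add: norm1_def sum_nonneg)

lemma norm1_eq_0_iff:
  assumes "u \<in> Rn n"
  shows "norm1 n u = 0 \<longleftrightarrow> u = zero_vec n"
proof
  assume "norm1 n u = 0"
  then have "\<forall>i\<in>{1..n}. u i = 0"
    by (simp add: norm1_def sum_nonneg_eq_0_iff)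
  with assms show "u = zero_vec n"
    by (auto simp: Rn_def zero_vec_def PiE_def extensional_def restrict_def)
qed (simp add: norm1_def zero_vec_def)

lemma powr_two_thirds_cube:
  assumes "0 \<le> (x::real)"
  shows "(x ^ 3) powr (2/3) = x\<^sup>2"
proof (cases "x = 0")
  case False
  then have "(x ^ 3) powr (2/3) = x powr (3 * (2/3))"
    using assms by (metis powr_powr powr_numeral order_le_less)
  then show ?thesis using assms False by simp
qed simp

text \<open>Outside a cube around \<open>y\<close> the quadratic term alone exceeds the value of the objective at
  \<open>y\<close>. The cube, with the fixed value outside the index set, is a product of compact sets.\<close>

lemma prox_nonempty:
  assumes "0 < \<nu>" "y \<in> Rn n"
  shows "prox n \<nu> y \<noteq> {}"
proof -
  let ?J = "J_fun n \<nu> y"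
  (* The summand 1 makes M \<le> M\<^sup>2, so no square root of the value at y is taken. *)
  define M where "M = 1 + 2 * ?J y"
  have J0: "?J y \<ge> 0" using assms by (simp add: J_fun_eq)
  then have M1: "M \<ge> 1" by (simp add: M_def)
  define K where "K i = (if i \<in> {1..n} then {y i - M .. y i + M} else {undefined})" for i
  define B where "B = Pi\<^sub>E UNIV K"
  have yB: "y \<in> B"
    using assms M1 by (auto simp: B_def K_def Rn_def PiE_def extensional_def)
  have BR: "B \<subseteq> Rn n"
    by (auto simp: B_def K_def Rn_def PiE_def extensional_def Pi_def)
  have "compactin (product_topology (\<lambda>i. euclidean) UNIV) B"
    unfolding B_def compactin_PiE by (auto simp: K_def)
  then have "compact B" by (simp add: euclidean_product_topology)
  moreover have "continuous_on B ?J"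
  proof -
    have c: "continuous_on B (\<lambda>u. u i)" for i :: nat
      by (rule continuous_on_product_then_coordinatewise) simp
    have "continuous_on B (\<lambda>u. norm1 n u powr (2/3))"
      by (rule continuous_on_powr')
        (auto simp: norm1_def intro!: continuous_intros c sum_nonneg)
    then have "continuous_on B (\<lambda>u. \<nu> * norm1 n u powr (2/3) + (\<Sum>i=1..n. (u i - y i)\<^sup>2) / 2)"
      by (intro continuous_on_add continuous_on_mult continuous_on_const continuous_on_divide
          continuous_on_sum continuous_on_power continuous_on_diff c) auto
    then show ?thesis by (simp add: J_fun_eq[abs_def])
  qed
  ultimately obtain u where u: "u \<in> B" "\<forall>v\<in>B. ?J u \<le> ?J v"
    using continuous_attains_inf[of B ?J] yB by blast
  have "?J u \<le> ?J v" if v: "v \<in> Rn n" for v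
  proof (cases "v \<in> B")
    case False
    then obtain i where "v i \<notin> K i" by (auto simp: B_def PiE_def Pi_def)
    with v have i: "i \<in> {1..n}" "\<bar>v i - y i\<bar> > M"
      by (auto simp: K_def Rn_def PiE_def extensional_def split: if_splits)
    have "M * 1 \<le> M * M" using M1 by (intro mult_left_mono) auto
    also have "M * M \<le> (v i - y i)\<^sup>2"
      using i M1 abs_le_square_iff[of M "v i - y i"] by (simp add: power2_eq_square)
    also have "(v i - y i)\<^sup>2 \<le> (\<Sum>i=1..n. (v i - y i)\<^sup>2)"
      using i by (intro member_le_sum) auto
    also have "(\<Sum>i=1..n. (v i - y i)\<^sup>2) \<le> 2 * ?J v"
      using assms by (simp add: J_fun_eq)
    finally have "?J y \<le> ?J v" using J0 by (simp add: M_def)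
    then show ?thesis using u(2) yB by fastforce
  qed (use u in blast)
  then have "u \<in> prox n \<nu> y" using u BR by (auto simp: prox_iff)
  then show ?thesis by blast
qed

section \<open>Nonzero minimizers\<close>

text \<open>The tangent of the concave function \<open>x powr (2/3)\<close> at \<open>t ^ 3\<close> bounds it from above: with
  \<open>a = b ^ 3\<close> the claim is \<open>0 \<le> (b - t)\<^sup>2 * (2 * b + t)\<close>.\<close>

lemma powr_two_thirds_le_tangent:
  assumes "0 \<le> (a::real)" "0 < t"
  shows "a powr (2/3) \<le> t\<^sup>2 + 2 * (a - t ^ 3) / (3 * t)"
proof -
  define b where "b = root 3 a"
  have b: "b \<ge> 0" "a = b ^ 3" using assms by (auto simp: b_def)
  have "0 \<le> (b - t)\<^sup>2 * (2 * b + t)" using b assms by simp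
  also have "\<dots> = (t\<^sup>2 + 2 * (a - t ^ 3) / (3 * t) - b\<^sup>2) * (3 * t)"
    using assms by (simp add: b(2) field_simps power2_eq_square power3_eq_cube)
  finally have "b\<^sup>2 \<le> t\<^sup>2 + 2 * (a - t ^ 3) / (3 * t)"
    using assms by (simp add: zero_le_mult_iff)
  then show ?thesis using b by (simp add: powr_two_thirds_cube)
qed

text \<open>The function \<open>c * \<bar>x\<bar> + (x - a)\<^sup>2 / 2\<close> is strongly convex, so it grows quadratically away
  from its minimizer \<open>max (a - c) 0\<close>.\<close>

lemma soft_threshold_growth:
  fixes a c x :: real
  assumes "0 \<le> a" "0 \<le> c"
  defines "w \<equiv> max (a - c) 0"
  shows "c * \<bar>w\<bar> + (w - a)\<^sup>2 / 2 + (x - w)\<^sup>2 / 2 \<le> c * \<bar>x\<bar> + (x - a)\<^sup>2 / 2"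
proof (cases "a \<ge> c")
  case True
  then have w: "w = a - c" by (simp add: w_def)
  have "c * x \<le> c * \<bar>x\<bar>" using assms by (intro mult_left_mono) auto
  moreover have "c * (a - c) + (a - c - a)\<^sup>2 / 2 + (x - (a - c))\<^sup>2 / 2 = c * x + (x - a)\<^sup>2 / 2"
    by (simp add: power2_eq_square field_simps)
  ultimately show ?thesis using True by (simp add: w)
next
  case False
  then have w: "w = 0" by (simp add: w_def)
  have "a * x \<le> a * \<bar>x\<bar>" using assms by (intro mult_left_mono) auto
  also have "\<dots> \<le> c * \<bar>x\<bar>" using False by (intro mult_right_mono) auto
  finally have "a * x \<le> c * \<bar>x\<bar>" .
  moreover have "(x - a)\<^sup>2 / 2 = a\<^sup>2 / 2 + x\<^sup>2 / 2 - a * x"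
    by (simp add: power2_eq_square field_simps)
  ultimately have "a\<^sup>2 / 2 + x\<^sup>2 / 2 \<le> c * \<bar>x\<bar> + (x - a)\<^sup>2 / 2" by linarith
  then show ?thesis by (simp add: w)
qed

text \<open>Replacing \<open>x powr (2/3)\<close> by its tangent at \<open>norm1 n u\<close> keeps the value of the objective at
  \<open>u\<close> and does not lower it elsewhere. So \<open>u\<close> minimizes the resulting sum of separate convex
  functions of the entries, and by \<open>soft_threshold_growth\<close> it is the only vector to do so.\<close>

lemma minimizer_is_soft_threshold:
  assumes \<nu>: "0 < \<nu>" and y: "\<forall>i\<in>{1..n}. 0 \<le> y i"
    and u: "u \<in> prox n \<nu> y" and t: "0 < t" "norm1 n u = t ^ 3"
    and i: "i \<in> {1..n}"
  shows "u i = max (y i - 2 * \<nu> / (3 * t)) 0"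
proof -
  define c where "c = 2 * \<nu> / (3 * t)"
  have c0: "c \<ge> 0" using \<nu> t by (simp add: c_def)
  define w where "w = (\<lambda>i\<in>{1..n}. max (y i - c) 0)"
  have "w \<in> Rn n" by (simp add: w_def Rn_def)
  then have "J_fun n \<nu> y u \<le> J_fun n \<nu> y w" using u by (simp add: prox_iff)
  moreover have "\<nu> * norm1 n w powr (2/3) \<le> \<nu> * (t\<^sup>2 + 2 * (norm1 n w - t ^ 3) / (3 * t))"
    using \<nu> t powr_two_thirds_le_tangent[of "norm1 n w" t] by (intro mult_left_mono) auto
  moreover have "\<nu> * (t\<^sup>2 + 2 * (norm1 n w - t ^ 3) / (3 * t))
      = \<nu> * t\<^sup>2 + c * norm1 n w - c * norm1 n u"
    using t by (simp add: c_def field_simps)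
  ultimately have le: "c * norm1 n u + (\<Sum>i=1..n. (u i - y i)\<^sup>2) / 2
      \<le> c * norm1 n w + (\<Sum>i=1..n. (w i - y i)\<^sup>2) / 2"
    using t by (simp add: J_fun_eq powr_two_thirds_cube)
  have sep: "c * norm1 n v + (\<Sum>i=1..n. (v i - y i)\<^sup>2) / 2
      = (\<Sum>i=1..n. c * \<bar>v i\<bar> + (v i - y i)\<^sup>2 / 2)" for v
    by (simp add: norm1_def sum.distrib sum_distrib_left sum_divide_distrib)
  have "(\<Sum>i=1..n. c * \<bar>w i\<bar> + (w i - y i)\<^sup>2 / 2 + (u i - w i)\<^sup>2 / 2)
      \<le> (\<Sum>i=1..n. c * \<bar>u i\<bar> + (u i - y i)\<^sup>2 / 2)"
  proof (intro sum_mono)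
    fix i assume "i \<in> {1..n}"
    then show "c * \<bar>w i\<bar> + (w i - y i)\<^sup>2 / 2 + (u i - w i)\<^sup>2 / 2 \<le> c * \<bar>u i\<bar> + (u i - y i)\<^sup>2 / 2"
      using y c0 soft_threshold_growth[of "y i" c "u i"] by (simp add: w_def)
  qed
  then have "(\<Sum>i=1..n. (u i - w i)\<^sup>2 / 2) \<le> 0"
    using le unfolding sep by (simp add: sum.distrib)
  moreover have "(u i - w i)\<^sup>2 / 2 \<le> (\<Sum>i=1..n. (u i - w i)\<^sup>2 / 2)"
    using i by (intro member_le_sum) auto
  ultimately have "(u i - w i)\<^sup>2 \<le> 0" by linarith
  then have "u i = w i" by simp
  then show ?thesis using i by (simp add: w_def c_def)
qed

text \<open>Raising all \<open>s\<close> entries of the support by the same amount, so that \<open>norm1\<close> becomes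
  \<open>x ^ 3\<close> with \<open>x > t\<close>, changes the objective by \<open>(x - t)\<^sup>2 / (2 * s)\<close> times a polynomial in \<open>x\<close>
  (the first-order term vanishes at a minimizer). That polynomial is therefore nonnegative for
  \<open>x > t\<close>, and by continuity at \<open>x = t\<close>.\<close>

lemma minimizer_curvature:
  assumes u: "u \<in> prox n \<nu> y" and t: "0 < t" "norm1 n u = t ^ 3"
    and s: "s \<in> {1..n}"
    and supp: "\<forall>i\<in>{1..s}. 0 \<le> u i \<and> u i - y i = - (2 * \<nu> / (3 * t))"
    and off: "\<forall>i\<in>{s+1..n}. u i = 0"
  shows "2/9 * \<nu> * real s \<le> t ^ 4"
proof -
  define k where "k = 2/9 * \<nu> * real s"
  define c where "c = 2 * \<nu> / (3 * t)"
  have s0: "real s > 0" using s by simp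
  have split: "(\<Sum>i=1..n. f i) = (\<Sum>i=1..s. f i) + (\<Sum>i=s+1..n. f i)" for f :: "nat \<Rightarrow> real"
    using s sum.ub_add_nat[of 1 s f "n - s"] by simp
  have norm_u: "(\<Sum>i=1..s. u i) = t ^ 3"
  proof -
    have "norm1 n u = (\<Sum>i=1..s. \<bar>u i\<bar>)" unfolding norm1_def split using off by simp
    then show ?thesis using supp t by simp
  qed
  have ineq: "3 * k / t * (t + 2 * x) \<le> (x\<^sup>2 + x * t + t\<^sup>2)\<^sup>2" if x: "t < x" for x
  proof -
    (* Adding d to each of the s entries brings the norm from t ^ 3 to x ^ 3. *)
    define d where "d = (x ^ 3 - t ^ 3) / s"
    have "t ^ 3 \<le> x ^ 3" using x t by (intro power_mono) auto
    then have d0: "d \<ge> 0" using s0 by (simp add: d_def)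
    define v where "v = (\<lambda>i\<in>{1..n}. if i \<le> s then u i + d else u i)"
    have vs: "v i = u i + d" if "i \<in> {1..s}" for i using that s by (simp add: v_def)
    have vo: "v i = u i" if "i \<in> {s+1..n}" for i using that by (simp add: v_def)
    have "norm1 n v = (\<Sum>i=1..s. \<bar>v i\<bar>)"
      unfolding norm1_def split using off vo by simp
    also have "\<dots> = (\<Sum>i=1..s. u i + d)" using supp vs d0 by (intro sum.cong) auto
    also have "\<dots> = x ^ 3" using s0 norm_u by (simp add: sum.distrib d_def)
    finally have nv: "norm1 n v = x ^ 3" .
    have "v \<in> Rn n" by (simp add: v_def Rn_def)
    then have "J_fun n \<nu> y u \<le> J_fun n \<nu> y v" using u by (simp add: prox_iff)
    moreover have "(\<Sum>i=1..s. (v i - y i)\<^sup>2) = (\<Sum>i=1..s. (d - c)\<^sup>2)"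
    proof (intro sum.cong refl)
      fix i assume i: "i \<in> {1..s}"
      then have "v i - y i = d - c" using vs supp by (force simp: c_def)
      then show "(v i - y i)\<^sup>2 = (d - c)\<^sup>2" by simp
    qed
    moreover have "(\<Sum>i=1..s. (u i - y i)\<^sup>2) = (\<Sum>i=1..s. c\<^sup>2)"
      using supp by (intro sum.cong refl) (simp add: c_def)
    moreover have "(\<Sum>i=s+1..n. (v i - y i)\<^sup>2) = (\<Sum>i=s+1..n. (u i - y i)\<^sup>2)"
      by (intro sum.cong refl) (simp add: vo)
    ultimately have "\<nu> * t\<^sup>2 + s * c\<^sup>2 / 2 \<le> \<nu> * x\<^sup>2 + s * (d - c)\<^sup>2 / 2"
      using t x unfolding J_fun_eq nv split by (simp add: powr_two_thirds_cube add_divide_distrib)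
    then have "0 \<le> 2 * s * (\<nu> * x\<^sup>2 + s * (d - c)\<^sup>2 / 2 - (\<nu> * t\<^sup>2 + s * c\<^sup>2 / 2))"
      by simp
    also have "\<dots> = 2 * s * \<nu> * (x\<^sup>2 - t\<^sup>2) + (s * d)\<^sup>2 - 2 * (s * d) * (s * c)"
      by (simp add: power2_eq_square field_simps)
    also have "\<dots> = 9 * k * (x\<^sup>2 - t\<^sup>2) + (x ^ 3 - t ^ 3)\<^sup>2 - 2 * (x ^ 3 - t ^ 3) * (3 * k / t)"
    proof -
      have "s * d = x ^ 3 - t ^ 3" using s0 by (simp add: d_def)
      moreover have "s * c = 3 * k / t" using t by (simp add: c_def k_def field_simps)
      moreover have "2 * s * \<nu> = 9 * k" by (simp add: k_def)
      ultimately show ?thesis by simp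
    qed
    also have "\<dots> = (x - t)\<^sup>2 * ((x\<^sup>2 + x * t + t\<^sup>2)\<^sup>2 - 3 * k / t * (t + 2 * x))"
      using t by (simp add: field_simps power2_eq_square power3_eq_cube)
    finally show ?thesis using x by (simp add: zero_le_mult_iff)
  qed
  have "3 * k / t * (t + 2 * t) \<le> (t\<^sup>2 + t * t + t\<^sup>2)\<^sup>2"
  proof (rule tendsto_le)
    show "((\<lambda>x. (x\<^sup>2 + x * t + t\<^sup>2)\<^sup>2) \<longlongrightarrow> (t\<^sup>2 + t * t + t\<^sup>2)\<^sup>2) (at_right t)"
      by (intro tendsto_intros)
    show "((\<lambda>x. 3 * k / t * (t + 2 * x)) \<longlongrightarrow> 3 * k / t * (t + 2 * t)) (at_right t)"
      by (intro tendsto_intros)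
    show "\<forall>\<^sub>F x in at_right t. 3 * k / t * (t + 2 * x) \<le> (x\<^sup>2 + x * t + t\<^sup>2)\<^sup>2"
      using eventually_at_right_less by (rule eventually_mono) (rule ineq)
  qed auto
  then have "9 * k \<le> 9 * t ^ 4" using t by (simp add: power2_eq_square power4_eq_xxxx field_simps)
  then show ?thesis by (simp add: k_def)
qed

section \<open>The quartic equation\<close>

text \<open>This is the inequality of arithmetic and geometric means for \<open>t ^ 4, p ^ 4, p ^ 4, p ^ 4\<close>.\<close>

lemma quartic_am_gm:
  fixes p t :: real
  assumes "0 < p" "0 < t"
  shows "4 * p ^ 3 * t \<le> t ^ 4 + 3 * p ^ 4"
    and "p \<noteq> t \<Longrightarrow> 4 * p ^ 3 * t < t ^ 4 + 3 * p ^ 4"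
proof -
  have eq: "t ^ 4 + 3 * p ^ 4 - 4 * p ^ 3 * t = (t - p)\<^sup>2 * (t\<^sup>2 + 2 * t * p + 3 * p\<^sup>2)"
    by (simp add: power2_eq_square power3_eq_cube power4_eq_xxxx algebra_simps)
  have pos: "0 < t\<^sup>2 + 2 * t * p + 3 * p\<^sup>2" using assms by (intro add_pos_pos) auto
  show "4 * p ^ 3 * t \<le> t ^ 4 + 3 * p ^ 4"
    using eq pos by (smt (verit) mult_nonneg_nonneg zero_le_power2)
  show "4 * p ^ 3 * t < t ^ 4 + 3 * p ^ 4" if "p \<noteq> t"
  proof -
    have "0 < (t - p)\<^sup>2 * (t\<^sup>2 + 2 * t * p + 3 * p\<^sup>2)" using that pos by simp
    then show ?thesis using eq by linarith
  qed
qed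

lemma powr_quarter_powers:
  assumes "0 < (k::real)"
  shows "(k powr (1/4)) ^ 4 = k" "(k powr (1/4)) ^ 3 = k powr (3/4)"
  using assms by (simp_all add: powr_powr flip: powr_realpow)

text \<open>With \<open>k = 2/9 * \<nu> * s\<close> and \<open>T = top_sum s y\<close> the equation reads \<open>T = t ^ 3 + 3 * k / t\<close>, whose least value over
  \<open>t > 0\<close> is \<open>4 * k powr (3/4)\<close>. This is the admissibility threshold.\<close>

lemma admissible_of_quartic:
  assumes "0 < \<nu>" "0 < s" "0 < t"
    and T: "top_sum s y * t = t ^ 4 + 2/3 * \<nu> * real s"
  shows "admissible \<nu> y s"
proof -
  define k where "k = 2/9 * \<nu> * real s"
  define p where "p = k powr (1/4)"
  have k0: "k > 0" using assms by (simp add: k_def)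
  have p0: "p > 0" using k0 by (simp add: p_def)
  have p4: "p ^ 4 = k" and p3: "p ^ 3 = k powr (3/4)"
    unfolding p_def by (rule powr_quarter_powers[OF k0])+
  have "4 * p ^ 3 * t \<le> top_sum s y * t"
    using quartic_am_gm(1)[OF p0 \<open>0 < t\<close>] T by (simp add: p4 k_def)
  then have "4 * p ^ 3 \<le> top_sum s y" using \<open>0 < t\<close> by simp
  moreover have "4 * p ^ 3 = (4/3 * (2 powr (3/4) / 3 powr (1/2)) * \<nu> powr (3/4)) * real s powr (3/4)"
  proof -
    have "(9::real) powr (3/4) = (3 powr 2) powr (3/4)" by simp
    also have "\<dots> = 3 powr (1 + 1/2)" unfolding powr_powr by simp
    also have "\<dots> = 3 * 3 powr (1/2)" by (subst powr_add) simp
    finally have "(9::real) powr (3/4) = 3 * 3 powr (1/2)" .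
    then show ?thesis
      using assms by (simp add: p3 k_def powr_mult powr_divide)
  qed
  ultimately show ?thesis by (simp add: admissible_def)
qed

text \<open>Cardano's formula for the resolvent cubic of the quartic \<open>t ^ 4 - T * t + 3 * k\<close>.\<close>

lemma cardano_resolvent:
  fixes T k :: real
  assumes "0 < T" "0 < k" "256 * k ^ 3 \<le> T ^ 4"
  defines "D \<equiv> sqrt (T ^ 4 / 256 - k ^ 3)"
  defines "a \<equiv> root 3 (T\<^sup>2 / 16 + D) + root 3 (T\<^sup>2 / 16 - D)"
  shows "0 < a" "a ^ 3 - 3 * k * a = T\<^sup>2 / 8"
proof -
  have D0: "D \<ge> 0" using assms by (simp add: D_def)
  have D2: "D\<^sup>2 = T ^ 4 / 256 - k ^ 3" using assms by (simp add: D_def)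
  have "D\<^sup>2 \<le> (T\<^sup>2 / 16)\<^sup>2" using D2 assms by (simp add: power_divide flip: power_mult)
  then have DT: "D \<le> T\<^sup>2 / 16" by (rule power2_le_imp_le) simp
  define A where "A = root 3 (T\<^sup>2 / 16 + D)"
  define B where "B = root 3 (T\<^sup>2 / 16 - D)"
  have "T\<^sup>2 / 16 + D > 0" using D0 assms by (intro add_pos_nonneg) auto
  then have A0: "A > 0" by (simp add: A_def)
  have B0: "B \<ge> 0" using DT by (simp add: B_def)
  have a: "a = A + B" by (simp add: a_def A_def B_def)
  show "0 < a" using A0 B0 a by simp
  have A3: "A ^ 3 = T\<^sup>2 / 16 + D" by (simp add: A_def odd_real_root_pow)
  have B3: "B ^ 3 = T\<^sup>2 / 16 - D" by (simp add: B_def odd_real_root_pow)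
  have "(A * B) ^ 3 = (T\<^sup>2 / 16)\<^sup>2 - D\<^sup>2"
    unfolding power_mult_distrib A3 B3 by (simp add: power2_eq_square algebra_simps)
  also have "\<dots> = k ^ 3" by (simp add: D2 power_divide flip: power_mult)
  finally have AB: "A * B = k"
    using A0 B0 assms by (intro power_eq_imp_eq_base[of "A * B" 3]) auto
  have "a ^ 3 = A ^ 3 + B ^ 3 + 3 * (A * B) * a"
    by (simp add: a power3_eq_cube algebra_simps)
  then show "a ^ 3 - 3 * k * a = T\<^sup>2 / 8" by (simp add: A3 B3 AB)
qed

text \<open>Ferrari's method. Completing the square with a root \<open>a\<close> of the resolvent cubic splits the
  quartic into two quadratics, and a positive \<open>t\<close> can be a root of one of them only. The bound
  \<open>k \<le> t ^ 4\<close> selects its larger root: the resolvent cubic is nonnegative at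
  \<open>2 * t\<^sup>2\<close> and increasing beyond, so \<open>a \<le> 2 * t\<^sup>2\<close>.\<close>

lemma ferrari_larger_root:
  fixes T k a t :: real
  assumes T0: "0 < T" and k: "0 < k" and t: "0 < t" "k \<le> t ^ 4" and quartic: "T * t = t ^ 4 + 3 * k"
    and a: "0 < a" and cubic: "a ^ 3 - 3 * k * a = T\<^sup>2 / 8"
  shows "sqrt (2 * a) + sqrt (2 * T / sqrt (2 * a) - 2 * a) = 2 * t"
proof -
  define m where "m = sqrt (2 * a)"
  have m0: "m > 0" using a by (simp add: m_def)
  have m2: "m\<^sup>2 = 2 * a" using a by (simp add: m_def)
  have "(t\<^sup>2 + a)\<^sup>2 = (m * t + T / (2 * m))\<^sup>2"
  proof -
    have "(m * t + T / (2 * m))\<^sup>2 = m\<^sup>2 * t\<^sup>2 + T * t + T\<^sup>2 / (4 * m\<^sup>2)"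
      using m0 by (simp add: power2_eq_square field_simps)
    also have "\<dots> = 2 * a * t\<^sup>2 + T * t + T\<^sup>2 / 8 / a" by (simp add: m2)
    also have "\<dots> = 2 * a * t\<^sup>2 + (t ^ 4 + 3 * k) + (a\<^sup>2 - 3 * k)"
    proof -
      have "T\<^sup>2 / 8 / a = a\<^sup>2 - 3 * k"
        unfolding cubic[symmetric] using a by (simp add: power2_eq_square power3_eq_cube field_simps)
      then show ?thesis by (simp add: quartic)
    qed
    also have "\<dots> = (t\<^sup>2 + a)\<^sup>2" by (simp add: power2_eq_square power4_eq_xxxx algebra_simps)
    finally show ?thesis ..
  qed
  then have "t\<^sup>2 + a = m * t + T / (2 * m)"
    by (rule power2_eq_imp_eq) (use a m0 t T0 in auto)
  then have "4 * t\<^sup>2 + 2 * m\<^sup>2 = 4 * (m * t) + 2 * T / m"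
    using m0 by (simp add: m2 field_simps)
  then have sq: "(2 * t - m)\<^sup>2 = 2 * T / m - 2 * a"
    using m2 by (simp add: power2_eq_square algebra_simps)
  have "a \<le> 2 * t\<^sup>2"
  proof (rule ccontr)
    assume neg: "\<not> a \<le> 2 * t\<^sup>2"
    define b where "b = 2 * t\<^sup>2"
    have ab: "a > b" and b0: "b > 0" using neg t by (auto simp: b_def)
    (* This is 8 * t\<^sup>2 times the value of the resolvent cubic at b, once T is eliminated. *)
    have "0 \<le> 9 * ((7 * t ^ 4 + k) * (t ^ 4 - k))" using t k by simp
    also have "\<dots> = 8 * t\<^sup>2 * (b ^ 3 - 3 * k * b) - (T * t)\<^sup>2"
      unfolding quartic b_def
      by (simp add: power2_eq_square power3_eq_cube power4_eq_xxxx algebra_simps)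
    also have "\<dots> = 8 * t\<^sup>2 * ((b ^ 3 - 3 * k * b) - (a ^ 3 - 3 * k * a))"
      unfolding cubic by (simp add: power2_eq_square algebra_simps)
    finally have "a ^ 3 - 3 * k * a \<le> b ^ 3 - 3 * k * b"
      using t by (simp add: zero_le_mult_iff)
    moreover have "(a ^ 3 - 3 * k * a) - (b ^ 3 - 3 * k * b) = (a - b) * (a\<^sup>2 + a * b + (b\<^sup>2 - 3 * k))"
      by (simp add: power2_eq_square power3_eq_cube algebra_simps)
    moreover have "0 < (a - b) * (a\<^sup>2 + a * b + (b\<^sup>2 - 3 * k))"
    proof -
      have "b\<^sup>2 = 4 * t ^ 4" by (simp add: b_def power_mult_distrib flip: power_mult)
      then have "b\<^sup>2 - 3 * k \<ge> 0" using t k by simp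
      then show ?thesis using ab b0 a by (intro mult_pos_pos add_pos_nonneg add_pos_pos) auto
    qed
    ultimately show False by linarith
  qed
  then have "m\<^sup>2 \<le> (2 * t)\<^sup>2" by (simp add: m2 power_mult_distrib)
  then have "m \<le> 2 * t" by (rule power2_le_imp_le) (use t in simp)
  then have "sqrt (2 * T / m - 2 * a) = 2 * t - m" by (simp flip: sq)
  then show ?thesis by (simp add: m_def)
qed

text \<open>The denominator in \<^const>\<open>c_s\<close> is twice the larger root of the quartic, by Ferrari's formula with
  the root \<^const>\<open>alpha\<close> of the resolvent cubic.\<close>

lemma c_s_eq:
  assumes "0 < \<nu>" "0 < s" "0 < t" "2/9 * \<nu> * real s \<le> t ^ 4"
    and T: "top_sum s y * t = t ^ 4 + 2/3 * \<nu> * real s"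
  shows "c_s \<nu> y s = 2 * \<nu> / (3 * t)"
proof -
  define k where "k = 2/9 * \<nu> * real s"
  have k0: "k > 0" using assms by (simp add: k_def)
  let ?T = "top_sum s y"
  have quartic: "?T * t = t ^ 4 + 3 * k" using T by (simp add: k_def)
  have "?T * t > 0" using assms k0 unfolding quartic by (intro add_pos_pos) auto
  then have T0: "?T > 0" using \<open>0 < t\<close> by (simp add: zero_less_mult_iff)
  have "256 * k ^ 3 \<le> ?T ^ 4"
  proof -
    define p where "p = k powr (1/4)"
    have p0: "p > 0" and p4: "p ^ 4 = k"
      using k0 powr_quarter_powers[OF k0] by (auto simp: p_def)
    have "4 * p ^ 3 * t \<le> ?T * t"
      using quartic_am_gm(1)[OF p0 \<open>0 < t\<close>] by (simp add: quartic p4)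
    then have "4 * p ^ 3 \<le> ?T" using \<open>0 < t\<close> by simp
    then have "(4 * p ^ 3) ^ 4 \<le> ?T ^ 4" using p0 by (intro power_mono) auto
    moreover have "(4 * p ^ 3) ^ 4 = 256 * k ^ 3"
      unfolding p4[symmetric] by (simp add: power_mult_distrib flip: power_mult)
    ultimately show ?thesis by simp
  qed
  note res = cardano_resolvent[OF T0 k0 this]
  have "k ^ 3 = 8 * \<nu> ^ 3 * real s ^ 3 / 729"
    by (simp add: k_def power_mult_distrib power_divide)
  then have al: "alpha \<nu> y s =
      root 3 (?T\<^sup>2 / 16 + sqrt (?T ^ 4 / 256 - k ^ 3)) + root 3 (?T\<^sup>2 / 16 - sqrt (?T ^ 4 / 256 - k ^ 3))"
    by (simp only: alpha_def)
  have "k \<le> t ^ 4" using assms by (simp add: k_def)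
  then have "sqrt (2 * alpha \<nu> y s) + sqrt (2 * ?T / sqrt (2 * alpha \<nu> y s) - 2 * alpha \<nu> y s) = 2 * t"
    using ferrari_larger_root[OF T0 k0 \<open>0 < t\<close> _ quartic] res unfolding al by blast
  then show ?thesis using assms by (simp add: c_s_def)
qed

section \<open>The structure of the proximal set\<close>

text \<open>The parameters of a nonzero minimizer: the size \<open>s\<close> of its support and the cube root \<open>t\<close> of
  its norm.\<close>

lemma nonzero_minimizer:
  assumes \<nu>: "0 < \<nu>" and y: "y \<in> Rn_down n"
    and u: "u \<in> prox n \<nu> y" "u \<noteq> zero_vec n"
  obtains s t where "s \<in> {1..n}" "0 < t" "norm1 n u = t ^ 3"
    "top_sum s y * t = t ^ 4 + 2/3 * \<nu> * real s" "2/9 * \<nu> * real s \<le> t ^ 4"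
    "c_s \<nu> y s = 2 * \<nu> / (3 * t)" "admissible \<nu> y s"
    "u = (\<lambda>i\<in>{1..n}. max (y i - c_s \<nu> y s) 0)"
    "\<And>i. i \<in> {1..s} \<Longrightarrow> y i > c_s \<nu> y s" "\<And>i. i \<in> {s+1..n} \<Longrightarrow> y i \<le> c_s \<nu> y s"
proof -
  have uR: "u \<in> Rn n" using u by (simp add: prox_iff)
  have mono: "y j \<le> y i" if "i \<in> {1..n}" "j \<in> {1..n}" "i \<le> j" for i j
    using y that unfolding Rn_down_def by blast
  define t where "t = root 3 (norm1 n u)"
  have "norm1 n u \<noteq> 0" using u norm1_eq_0_iff[OF uR] by simp
  then have "norm1 n u > 0" using norm1_nonneg[of n u] by linarith
  then have t: "t > 0" "norm1 n u = t ^ 3" by (auto simp: t_def)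
  define c where "c = 2 * \<nu> / (3 * t)"
  have c0: "c > 0" using \<nu> t by (simp add: c_def)
  have ui: "u i = max (y i - c) 0" if "i \<in> {1..n}" for i
    using minimizer_is_soft_threshold[OF \<nu> _ u(1) t that] y by (simp add: c_def Rn_down_def)
  define P where "P = {i \<in> {1..n}. y i > c}"
  have "P \<noteq> {}"
  proof
    assume "P = {}"
    then have "\<forall>i\<in>{1..n}. u i = 0" using ui by (auto simp: P_def)
    then show False using t by (simp add: norm1_def)
  qed
  define s where "s = Max P"
  have sP: "s \<in> P" using \<open>P \<noteq> {}\<close> unfolding s_def by (intro Max_in) (auto simp: P_def)
  then have s: "s \<in> {1..n}" "y s > c" by (auto simp: P_def)
  have on: "y i > c" if "i \<in> {1..s}" for i
    using mono[of i s] that s by fastforce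
  have off: "y i \<le> c" if "i \<in> {s+1..n}" for i
  proof (rule ccontr)
    assume "\<not> ?thesis"
    then have "i \<in> P" using that by (auto simp: P_def)
    then have "i \<le> s" unfolding s_def by (intro Max_ge) (auto simp: P_def)
    then show False using that by simp
  qed
  have uon: "u i = y i - c" if "i \<in> {1..s}" for i using ui[of i] on[OF that] that s by auto
  have uoff: "u i = 0" if "i \<in> {s+1..n}" for i using ui[of i] off[OF that] that by auto
  have split: "(\<Sum>i=1..n. f i) = (\<Sum>i=1..s. f i) + (\<Sum>i=s+1..n. f i)" for f :: "nat \<Rightarrow> real"
    using s sum.ub_add_nat[of 1 s f "n - s"] by simp
  have "t ^ 3 = (\<Sum>i=1..s. \<bar>u i\<bar>)" using uoff unfolding t(2)[symmetric] norm1_def split by simp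
  also have "\<dots> = (\<Sum>i=1..s. y i - c)" using uon on by (intro sum.cong) (auto simp: less_imp_le)
  also have "\<dots> = top_sum s y - s * c" by (simp add: sum_subtractf top_sum_def)
  finally have "top_sum s y = t ^ 3 + s * c" by simp
  then have T: "top_sum s y * t = t ^ 4 + 2/3 * \<nu> * real s"
    using t by (simp add: c_def field_simps power3_eq_cube power4_eq_xxxx)
  have curv: "2/9 * \<nu> * real s \<le> t ^ 4"
  proof (rule minimizer_curvature[OF u(1) t s(1)])
    show "\<forall>i\<in>{1..s}. 0 \<le> u i \<and> u i - y i = - (2 * \<nu> / (3 * t))"
      using uon on by (auto simp: less_imp_le simp flip: c_def)
    show "\<forall>i\<in>{s+1..n}. u i = 0" using uoff by blast
  qed
  have s0: "0 < s" using s by simp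
  have cs: "c_s \<nu> y s = c" unfolding c_def by (rule c_s_eq[OF \<nu> s0 t(1) curv T])
  show ?thesis
  proof (rule that[OF s(1) t T curv])
    show "c_s \<nu> y s = 2 * \<nu> / (3 * t)" by (simp add: cs c_def)
    show "admissible \<nu> y s" by (rule admissible_of_quartic[OF \<nu> s0 t(1) T])
    show "u = (\<lambda>i\<in>{1..n}. max (y i - c_s \<nu> y s) 0)"
      using uR ui by (auto simp: cs Rn_def PiE_def extensional_def restrict_def)
    show "y i > c_s \<nu> y s" if "i \<in> {1..s}" for i using on[OF that] by (simp add: cs)
    show "y i \<le> c_s \<nu> y s" if "i \<in> {s+1..n}" for i using off[OF that] by (simp add: cs)
  qed
qed

lemma prox_subset_zero_S23:
  assumes "0 < \<nu>" "y \<in> Rn_down n"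
  shows "prox n \<nu> y \<subseteq> {zero_vec n} \<union> S23 n \<nu> y"
proof
  fix u assume u: "u \<in> prox n \<nu> y"
  show "u \<in> {zero_vec n} \<union> S23 n \<nu> y"
  proof (cases "u = zero_vec n")
    case False
    from nonzero_minimizer[OF assms u False] obtain s where
      s: "s \<in> {1..n}" "admissible \<nu> y s" "u = (\<lambda>i\<in>{1..n}. max (y i - c_s \<nu> y s) 0)"
      "\<And>i. i \<in> {1..s} \<Longrightarrow> y i > c_s \<nu> y s" "\<And>i. i \<in> {s+1..n} \<Longrightarrow> y i \<le> c_s \<nu> y s"
      by metis
    moreover have "y s > c_s \<nu> y s" using s by simp
    ultimately show ?thesis unfolding S23_def by blast
  qed simp
qed

text \<open>With \<open>c = 2 * \<nu> / (3 * t)\<close> one has \<open>u i * y i = u i * (u i + c)\<close>, so comparing \<open>u\<close> with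
  \<open>0\<close> leaves \<open>\<nu> * t\<^sup>2 / 3 \<le> (\<Sum>i=1..n. (u i)\<^sup>2) / 2\<close>, and the last sum is at most \<open>t ^ 6\<close>.\<close>

lemma nonzero_minimizer_bound:
  assumes \<nu>: "0 < \<nu>" and u: "u \<in> prox n \<nu> y" and t: "0 < t" "norm1 n u = t ^ 3"
    and ui: "\<And>i. i \<in> {1..n} \<Longrightarrow> u i = max (y i - 2 * \<nu> / (3 * t)) 0"
  shows "2/3 * \<nu> \<le> t ^ 4"
proof -
  define c where "c = 2 * \<nu> / (3 * t)"
  have "zero_vec n \<in> Rn n" by (simp add: zero_vec_def Rn_def)
  then have "J_fun n \<nu> y u \<le> J_fun n \<nu> y (zero_vec n)" using u by (simp add: prox_iff)
  then have le: "\<nu> * t\<^sup>2 + (\<Sum>i=1..n. (u i - y i)\<^sup>2) / 2 \<le> (\<Sum>i=1..n. (y i)\<^sup>2) / 2"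
    using t by (simp add: J_fun_eq powr_two_thirds_cube) (simp add: norm1_def zero_vec_def)
  have "(\<Sum>i=1..n. (u i - y i)\<^sup>2) = (\<Sum>i=1..n. (y i)\<^sup>2 - (u i)\<^sup>2 - 2 * c * \<bar>u i\<bar>)"
  proof (intro sum.cong refl)
    fix i assume i: "i \<in> {1..n}"
    show "(u i - y i)\<^sup>2 = (y i)\<^sup>2 - (u i)\<^sup>2 - 2 * c * \<bar>u i\<bar>"
      unfolding ui[OF i, folded c_def]
      by (cases "y i \<le> c") (auto simp: power2_eq_square algebra_simps)
  qed
  also have "\<dots> = (\<Sum>i=1..n. (y i)\<^sup>2) - (\<Sum>i=1..n. (u i)\<^sup>2) - 2 * c * t ^ 3"
    by (simp add: sum_subtractf norm1_def flip: sum_distrib_left t(2))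
  finally have "\<nu> * t\<^sup>2 - c * t ^ 3 \<le> (\<Sum>i=1..n. (u i)\<^sup>2) / 2" using le by linarith
  moreover have "c * t ^ 3 = 2/3 * \<nu> * t\<^sup>2"
    using t by (simp add: c_def power2_eq_square power3_eq_cube)
  moreover have "(\<Sum>i=1..n. (u i)\<^sup>2) \<le> (t ^ 3)\<^sup>2"
  proof -
    have "L2_set u {1..n} \<le> t ^ 3" using L2_set_le_sum_abs[of u "{1..n}"] t by (simp add: norm1_def)
    then have "(L2_set u {1..n})\<^sup>2 \<le> (t ^ 3)\<^sup>2" by (intro power_mono) auto
    then show ?thesis by (simp add: L2_set_def sum_nonneg)
  qed
  moreover have "(t ^ 3)\<^sup>2 = t ^ 4 * t\<^sup>2" by (simp flip: power_mult power_add)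
  ultimately have "2/3 * \<nu> * t\<^sup>2 \<le> t ^ 4 * t\<^sup>2" by linarith
  then show ?thesis by (rule mult_right_le_imp_le) (use t in simp)
qed

text \<open>A nonzero minimizer gives \<open>norm1 n y \<ge> top_sum s y \<ge> t ^ 3 + 2 * \<nu> / (3 * t)\<close>. The right-hand side, as a
  function of \<open>t\<close>, takes its least value, which is the given threshold, only where
  \<open>t ^ 4 = 2/9 * \<nu>\<close>, and \<open>nonzero_minimizer_bound\<close> excludes that point.\<close>

lemma prox_eq_zero:
  assumes \<nu>: "0 < \<nu>" and y: "y \<in> Rn_down n"
    and small: "norm1 n y \<le> 4 * (2/9) powr (3/4) * \<nu> powr (3/4)"
  shows "prox n \<nu> y = {zero_vec n}"
proof -
  have "u = zero_vec n" if u: "u \<in> prox n \<nu> y" for u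
  proof (rule ccontr)
    assume nz: "u \<noteq> zero_vec n"
    from nonzero_minimizer[OF \<nu> y u nz] obtain s t where
      s: "s \<in> {1..n}" and t: "0 < t" "norm1 n u = t ^ 3"
      and T: "top_sum s y * t = t ^ 4 + 2/3 * \<nu> * real s"
      and c: "c_s \<nu> y s = 2 * \<nu> / (3 * t)"
      and u_eq: "u = (\<lambda>i\<in>{1..n}. max (y i - c_s \<nu> y s) 0)" by metis
    have t4: "2/3 * \<nu> \<le> t ^ 4"
      by (rule nonzero_minimizer_bound[OF \<nu> u t]) (simp add: u_eq c)
    define k where "k = 2/9 * \<nu>"
    define p where "p = k powr (1/4)"
    have k0: "k > 0" using \<nu> by (simp add: k_def)
    have p0: "p > 0" using k0 by (simp add: p_def)
    have p4: "p ^ 4 = k" and p3: "p ^ 3 = k powr (3/4)"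
      unfolding p_def by (rule powr_quarter_powers[OF k0])+
    have "p \<noteq> t" using t4 p4 \<nu> by (auto simp: k_def)
    then have "4 * p ^ 3 * t < t ^ 4 + 3 * p ^ 4" using quartic_am_gm(2) p0 t by blast
    also have "\<dots> = t ^ 4 + 2/3 * \<nu> * 1" by (simp add: p4 k_def)
    also have "\<dots> \<le> top_sum s y * t"
      unfolding T using s \<nu> by (intro add_left_mono mult_left_mono) auto
    finally have "4 * p ^ 3 < top_sum s y" using t by simp
    also have "top_sum s y \<le> norm1 n y"
    proof -
      have "top_sum s y \<le> (\<Sum>i=1..s. \<bar>y i\<bar>)" unfolding top_sum_def by (intro sum_mono) auto
      also have "\<dots> \<le> norm1 n y" unfolding norm1_def using s by (intro sum_mono2) auto
      finally show ?thesis .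
    qed
    also note small
    also have "4 * (2/9) powr (3/4) * \<nu> powr (3/4) = 4 * p ^ 3"
      unfolding p3 k_def using \<nu> by (subst powr_mult) auto
    finally show False by simp
  qed
  moreover have "prox n \<nu> y \<noteq> {}" using y by (intro prox_nonempty[OF \<nu>]) (simp add: Rn_down_def)
  ultimately show ?thesis by blast
qed

text \<open>The vector with the single nonzero entry \<open>q = (2/3 * \<nu>) powr (3/4)\<close> changes the objective by
  \<open>q * (2 * q - y i)\<close> from its value at \<open>0\<close>. Among the multiples of the unit vector this \<open>q\<close> is
  the one for which the least \<open>y i\<close> suffices.\<close>

lemma zero_notin_prox:
  assumes \<nu>: "0 < \<nu>" and i: "i \<in> {1..n}" and big: "y i > 2 * (2/3 * \<nu>) powr (3/4)"
  shows "zero_vec n \<notin> prox n \<nu> y"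
proof
  assume z: "zero_vec n \<in> prox n \<nu> y"
  define w where "w = (2/3 * \<nu>) powr (1/4)"
  have w0: "w > 0" using \<nu> by (simp add: w_def)
  have w4: "w ^ 4 = 2/3 * \<nu>" and w3: "w ^ 3 = (2/3 * \<nu>) powr (3/4)"
    unfolding w_def using \<nu> by (intro powr_quarter_powers; simp)+
  define v where "v = (\<lambda>j\<in>{1..n}. if j = i then w ^ 3 else 0)"
  have "v \<in> Rn n" by (simp add: v_def Rn_def)
  then have "J_fun n \<nu> y (zero_vec n) \<le> J_fun n \<nu> y v" using z by (simp add: prox_iff)
  moreover have "J_fun n \<nu> y (zero_vec n) = (\<Sum>j=1..n. (y j)\<^sup>2) / 2"
    by (simp add: J_fun_eq norm1_def zero_vec_def)
  moreover have "J_fun n \<nu> y v = \<nu> * w\<^sup>2 + (\<Sum>j=1..n. (y j)\<^sup>2) / 2 + ((w ^ 3)\<^sup>2 - 2 * w ^ 3 * y i) / 2"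
  proof -
    have "norm1 n v = (\<Sum>j=1..n. if j = i then w ^ 3 else 0)"
      unfolding norm1_def using w0 by (intro sum.cong) (auto simp: v_def)
    then have nv: "norm1 n v = w ^ 3" using i by simp
    have "(\<Sum>j=1..n. (v j - y j)\<^sup>2)
        = (\<Sum>j=1..n. (y j)\<^sup>2 + (if j = i then (w ^ 3)\<^sup>2 - 2 * w ^ 3 * y i else 0))"
      by (intro sum.cong) (auto simp: v_def power2_diff algebra_simps)
    also have "\<dots> = (\<Sum>j=1..n. (y j)\<^sup>2) + ((w ^ 3)\<^sup>2 - 2 * w ^ 3 * y i)"
      using i by (simp add: sum.distrib)
    finally show ?thesis using w0 by (simp add: J_fun_eq nv powr_two_thirds_cube add_divide_distrib)
  qed
  ultimately have "0 \<le> \<nu> * w\<^sup>2 + ((w ^ 3)\<^sup>2 - 2 * w ^ 3 * y i) / 2" by linarith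
  also have "\<dots> = (3/2 * w ^ 4) * w\<^sup>2 + ((w ^ 3)\<^sup>2 - 2 * w ^ 3 * y i) / 2" by (simp add: w4)
  also have "\<dots> = w ^ 3 * (2 * w ^ 3 - y i)"
    by (simp add: power2_eq_square power3_eq_cube power4_eq_xxxx field_simps)
  finally have "y i \<le> 2 * w ^ 3" using w0 by (simp add: zero_le_mult_iff)
  then show False using big w3 by simp
qed

text \<open>With \<open>w = (2/3 * \<nu>) powr (1/4)\<close> the threshold is \<open>c = w ^ 4 / t\<close>. The curvature bound gives
  \<open>t ^ 4 \<ge> w ^ 4 / 3\<close>, hence \<open>t \<ge> w / 2\<close> and \<open>c \<le> 2 * w ^ 3\<close>: no entry of \<open>y\<close> is cut off.\<close>

lemma prox_all_gt:
  assumes n: "0 < n" and \<nu>: "0 < \<nu>" and y: "y \<in> Rn_down n"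
    and big: "all_gt n y (2 * (2/3 * \<nu>) powr (3/4))"
  shows "prox n \<nu> y = {\<lambda>i\<in>{1..n}. y i - c_s \<nu> y n}"
proof -
  have "u = (\<lambda>i\<in>{1..n}. y i - c_s \<nu> y n)" if u: "u \<in> prox n \<nu> y" for u
  proof -
    have "zero_vec n \<notin> prox n \<nu> y"
      using zero_notin_prox[OF \<nu>, of 1] big n by (simp add: all_gt_def)
    then have nz: "u \<noteq> zero_vec n" using u by blast
    from nonzero_minimizer[OF \<nu> y u nz] obtain s t where
      s: "s \<in> {1..n}" and t: "0 < t" and curv: "2/9 * \<nu> * real s \<le> t ^ 4"
      and c: "c_s \<nu> y s = 2 * \<nu> / (3 * t)"
      and u_eq: "u = (\<lambda>i\<in>{1..n}. max (y i - c_s \<nu> y s) 0)"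
      and on: "\<And>i. i \<in> {1..s} \<Longrightarrow> y i > c_s \<nu> y s"
      and off: "\<And>i. i \<in> {s+1..n} \<Longrightarrow> y i \<le> c_s \<nu> y s" by metis
    define w where "w = (2/3 * \<nu>) powr (1/4)"
    have w0: "w > 0" using \<nu> by (simp add: w_def)
    have w4: "w ^ 4 = 2/3 * \<nu>" and w3: "w ^ 3 = (2/3 * \<nu>) powr (3/4)"
      unfolding w_def using \<nu> by (intro powr_quarter_powers; simp)+
    have "2/9 * \<nu> * 1 \<le> 2/9 * \<nu> * real s" using s \<nu> by (intro mult_left_mono) auto
    then have "2/9 * \<nu> \<le> t ^ 4" using curv by simp
    moreover have "(w / 2) ^ 4 = \<nu> / 24" by (simp add: power_divide w4)
    ultimately have "(w / 2) ^ 4 \<le> t ^ 4" using \<nu> by simp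
    then have "w / 2 \<le> t" using t by (simp add: power_mono_iff w0 less_imp_le)
    then have "w ^ 3 * w \<le> w ^ 3 * (2 * t)" using w0 by (intro mult_left_mono) auto
    then have "w ^ 4 \<le> 2 * w ^ 3 * t" by (simp add: power3_eq_cube power4_eq_xxxx)
    then have "c_s \<nu> y s \<le> 2 * w ^ 3" using t w4 by (simp add: c field_simps)
    have "s = n"
    proof (rule ccontr)
      assume "s \<noteq> n"
      then have "y n \<le> c_s \<nu> y s" using s by (intro off) auto
      moreover have "y n > 2 * w ^ 3" using big n by (simp add: all_gt_def w3)
      ultimately show False using \<open>c_s \<nu> y s \<le> 2 * w ^ 3\<close> by simp
    qed
    then show ?thesis
      unfolding u_eq using on by (intro restrict_ext) (simp add: max_absorb1 less_imp_le)
  qed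
  moreover have "prox n \<nu> y \<noteq> {}" using y by (intro prox_nonempty[OF \<nu>]) (simp add: Rn_down_def)
  ultimately show ?thesis by blast
qed

theorem corollary3p8:
  fixes n :: nat and \<nu> :: real and y :: rvec
  assumes "n > 0" and "\<nu> > 0" and "y \<in> Rn_down n"
  shows "prox n \<nu> y =
    (if norm1 n y \<le> 4 * (2/9) powr (3/4) * \<nu> powr (3/4) then {zero_vec n}
     else if all_gt n y (2 * (2/3 * \<nu>) powr (3/4)) then {\<lambda>i\<in>{1..n}. y i - c_s \<nu> y n}
     else if norm_inf n y > 2 * (2/3 * \<nu>) powr (3/4) \<and> \<not> all_gt n y (2 * (2/3 * \<nu>) powr (3/4))
       then argmin_set (J_fun n \<nu> y) (S23 n \<nu> y)
     else argmin_set (J_fun n \<nu> y) ({zero_vec n} \<union> S23 n \<nu> y))"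
proof -
  have yR: "y \<in> Rn n" and y0: "\<And>i. i \<in> {1..n} \<Longrightarrow> 0 \<le> y i"
    using assms(3) by (auto simp: Rn_down_def)
  have eq: "prox n \<nu> y = argmin_set (J_fun n \<nu> y) A" if "prox n \<nu> y \<subseteq> A" "A \<subseteq> Rn n" for A
    unfolding prox_def
    by (rule argmin_set_between) (use that prox_nonempty[OF assms(2) yR] in \<open>simp_all add: prox_def\<close>)
  have SR: "{zero_vec n} \<union> S23 n \<nu> y \<subseteq> Rn n"
    by (auto simp: S23_def zero_vec_def Rn_def)
  note sub = prox_subset_zero_S23[OF assms(2,3)]
  have "prox n \<nu> y = argmin_set (J_fun n \<nu> y) (S23 n \<nu> y)"
    if "norm_inf n y > 2 * (2/3 * \<nu>) powr (3/4)"
  proof (rule eq)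
    have "norm_inf n y \<in> (\<lambda>i. \<bar>y i\<bar>) ` {1..n}"
      unfolding norm_inf_def using assms(1) by (intro Max_in) auto
    then obtain i where i: "i \<in> {1..n}" "norm_inf n y = \<bar>y i\<bar>" by blast
    then have "y i > 2 * (2/3 * \<nu>) powr (3/4)" using that y0 by simp
    then have "zero_vec n \<notin> prox n \<nu> y" by (rule zero_notin_prox[OF assms(2) i(1)])
    then show "prox n \<nu> y \<subseteq> S23 n \<nu> y" using sub by blast
    show "S23 n \<nu> y \<subseteq> Rn n" using SR by blast
  qed
  then show ?thesis
    using prox_eq_zero[OF assms(2,3)] prox_all_gt[OF assms] eq[OF sub SR]
    by (simp only: split: if_split) blast
qed

end
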